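(* Suppose $k\in\mathbb{N}$ and $C$ is a rectifiable closed curve in $\Delta^k$. Then there exists a sequence $x\colon\mathbb{N}\to[k]$ such that $\operatorname{CP}(r^x)=C$.
   Context: $[k]=\{1,\dots,k\}$ and $\Delta^k=\{d=(d_1,\dots,d_k)\in\mathbb{R}^k\colon \sum_{i=1}^k d_i=1,\ d_i\ge 0\ \forall i\in[k]\}$ is the $(k-1)$-simplex, with the topology induced by the Euclidean norm. For a sequence $x\colon\mathbb{N}\to[k]$, the relative frequency of $i\in[k]$ at $n$ is $r^x_i(n)=\frac1n|\{j\in[n]\colon x_j=i\}|$, and $r^x\colon\mathbb{N}\to\Delta^k$ is $r^x(n)=(r^x_1(n),\dots,r^x_k(n))$. A point $z\in\Delta^k$ is a cluster point of a sequence $r\colon\mathbb{N}\to\Delta^k$ if for every $\epsilon>0$ there are infinitely many $n$ with $\|r(n)-z\|<\epsilon$; $\operatorname{CP}(r)$ denotes the set of all cluster points of $r$. A curve $C$ is identified with the image of a parametrization $c\colon[0,1]\to\Delta^k$. *)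

theory Defs
  imports "HOL-Analysis.Analysis"
begin

text \<open>
  The finite index type \<open>'k\<close> plays the role of $[k]$, with $k$ the cardinality of \<open>'k\<close>.
  The case $k = 0$, not covered by a type, is vacuous: the simplex is then empty and contains
  no curve. Sequences are functions on \<open>nat\<close> of which only the values at positive indices matter.
\<close>

definition prob_simplex :: "(real ^ 'k) set" where
  "prob_simplex = {d. (\<Sum>i\<in>UNIV. d $ i) = 1 \<and> (\<forall>i. 0 \<le> d $ i)}"

definition rel_freq :: "(nat \<Rightarrow> 'k) \<Rightarrow> nat \<Rightarrow> real ^ 'k" where
  "rel_freq x n = (\<chi> i. real (card {j \<in> {1..n}. x j = i}) / real n)"

definition cluster_points :: "(nat \<Rightarrow> real ^ 'k) \<Rightarrow> (real ^ 'k) set" where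
  "cluster_points r =
     {z \<in> prob_simplex. \<forall>\<epsilon>>0. infinite {n. 1 \<le> n \<and> norm (r n - z) < \<epsilon>}}"

text \<open>Finite length: the inscribed polygonal lengths over all partitions
  $0 = t_0 \le \dots \le t_m = 1$ are bounded.\<close>

definition rectifiable :: "(real \<Rightarrow> 'a::real_normed_vector) \<Rightarrow> bool" where
  "rectifiable c \<longleftrightarrow>
     bdd_above {(\<Sum>i<m. norm (c (t (Suc i)) - c (t i))) | m t.
       t 0 = 0 \<and> t m = 1 \<and> (\<forall>i<m. t i \<le> t (Suc i))}"

text \<open>Curves are images of parametrizations; self-intersections are allowed.\<close>

definition rectifiable_closed_curve :: "'a::real_normed_vector set \<Rightarrow> bool" where
  "rectifiable_closed_curve C \<longleftrightarrow>
     (\<exists>c. path c \<and> pathfinish c = pathstart c \<and> rectifiable c \<and> path_image c = C)"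

end

theory Submission
  imports Defs "HOL-Real_Asymp.Real_Asymp"
begin

text \<open>
  Let \<open>f\<close> be a periodic uniformly continuous map of the line onto \<open>C\<close>, running back and forth along
  the curve. The points \<open>f (ln (ln n))\<close> vary so slowly that their Cesaro means are asymptotic to
  the points themselves, while their cluster points are exactly \<open>C\<close>. A greedy rounding yields letters
  whose relative frequencies differ from those means by at most a constant over \<open>n\<close>.
\<close>

text \<open>
  Greedy choice: the next letter is one with a positive deficit \<open>E\<close>. It exists because the
  deficits sum to 1 before the letter is added. Hence no deficit drops below \<open>-1\<close>, and as they
  sum to 0 after the letter is added, none is large.
\<close>

lemma exists_rel_freq_asymp_mean:
  fixes z :: "nat \<Rightarrow> real ^ 'k"
  assumes z: "\<And>n. z n \<in> prob_simplex"
  shows "\<exists>x :: nat \<Rightarrow> 'k. (\<lambda>n. rel_freq x n - (\<Sum>m=1..n. z m) /\<^sub>R real n) \<longlonglongrightarrow> 0"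
proof -
  \<comment> \<open>Invariant of the deficit vector: the sum of the targets \<open>z m\<close> so
    far minus the letter counts so far. The index argument fits the shape of
    \<open>dependent_nat_choice\<close>.\<close>
  define P where "P = (\<lambda>(_::nat) (E :: real ^ 'k). (\<Sum>i\<in>UNIV. E $ i) = 0 \<and> (\<forall>i. -1 \<le> E $ i))"
  have step: "\<exists>E'. P (Suc n) E' \<and> (\<exists>i. E' = E + z (Suc n) - axis i 1)" if "P n E" for n E
  proof -
    define F where "F = E + z (Suc n)"
    have F1: "(\<Sum>i\<in>UNIV. F $ i) = 1"
      using that z[of "Suc n"] by (simp add: F_def P_def prob_simplex_def sum.distrib)
    have F2: "-1 \<le> F $ i" for i
      using that z[of "Suc n"] by (simp add: F_def P_def prob_simplex_def add_increasing2)
    obtain i where i: "0 < F $ i"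
      using F1 sum_nonpos[of UNIV "\<lambda>i. F $ i"] by (metis not_le zero_less_one)
    have "(\<Sum>j\<in>UNIV. (F - axis i 1) $ j) = 0"
      by (simp add: sum_subtractf F1 axis_def)
    moreover have "-1 \<le> (F - axis i 1) $ j" for j
      using F2[of j] i by (auto simp: axis_def)
    ultimately show ?thesis
      unfolding P_def F_def by blast
  qed
  have "P 0 0"
    by (simp add: P_def)
  \<comment> \<open>The choice principle only returns values satisfying a predicate, so the start
    value \<open>E 0 = 0\<close> is carried along as an implication.\<close>
  then have "\<exists>E. \<forall>n. (P n (E n) \<and> (n = 0 \<longrightarrow> E n = 0)) \<and> (\<exists>i. E (Suc n) = E n + z (Suc n) - axis i 1)"
    by (intro dependent_nat_choice) (use step in auto)
  then obtain E where E0: "E 0 = 0" and EP: "\<And>n. P n (E n)"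
    and EQ: "\<And>n. \<exists>i. E (Suc n) = E n + z (Suc n) - axis i 1"
    by blast
  obtain y where y: "\<And>n. E (Suc n) = E n + z (Suc n) - axis (y n) 1"
    using EQ by metis
  \<comment> \<open>\<open>y n\<close> is the letter picked in passing from time \<open>n\<close> to
    \<open>n + 1\<close>, while frequencies count positions \<open>1..n\<close>; hence the shift by
    one.\<close>
  define x where "x = (\<lambda>n. y (n - 1))"
  have count: "(\<chi> i. real (card {j \<in> {1..n}. x j = i})) = (\<Sum>m=1..n. z m) - E n" for n
  proof (induction n)
    case 0
    then show ?case by (simp add: E0 vec_eq_iff)
  next
    case (Suc n)
    have "{j \<in> {1..Suc n}. x j = i}
        = (if x (Suc n) = i then insert (Suc n) {j \<in> {1..n}. x j = i} else {j \<in> {1..n}. x j = i})" for i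
      by (auto simp: le_Suc_eq)
    then have "(\<chi> i. real (card {j \<in> {1..Suc n}. x j = i}))
        = (\<chi> i. real (card {j \<in> {1..n}. x j = i})) + axis (x (Suc n)) 1"
      by (auto simp: vec_eq_iff axis_def)
    also have "\<dots> = (\<Sum>m=1..Suc n. z m) - E (Suc n)"
      unfolding Suc y by (simp add: x_def)
    finally show ?case .
  qed
  have diff: "rel_freq x n - (\<Sum>m=1..n. z m) /\<^sub>R real n = - (E n /\<^sub>R real n)" for n
  proof -
    have "rel_freq x n = (\<chi> i. real (card {j \<in> {1..n}. x j = i})) /\<^sub>R real n"
      by (simp add: rel_freq_def vec_eq_iff divide_inverse_commute)
    then show ?thesis
      by (simp only: count) (simp add: scaleR_diff_right)
  qed
  define K where "K = real CARD('k)"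
  have "norm (E n) \<le> K * K" for n
  proof -
    have lower: "-1 \<le> E n $ i" for i
      using EP[of n] by (simp add: P_def)
    have "\<bar>E n $ i\<bar> \<le> K" for i
    proof -
      \<comment> \<open>Raising every entry by 1 makes all entries nonnegative with total
        \<open>K\<close>, so no single one exceeds \<open>K\<close>.\<close>
      have "(\<Sum>j\<in>UNIV. E n $ j + 1) = K"
        using EP[of n] by (simp add: P_def K_def sum.distrib)
      moreover have "E n $ i + 1 \<le> (\<Sum>j\<in>UNIV. E n $ j + 1)"
      proof (rule member_le_sum)
        show "0 \<le> E n $ j + 1" for j
          using EP[of n] by (simp add: P_def) (smt (verit))
      qed auto
      moreover have "1 \<le> K"
        by (simp add: K_def Suc_leI)
      ultimately show ?thesis
        using lower[of i] by linarith
    qed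
    then have "(\<Sum>i\<in>UNIV. \<bar>E n $ i\<bar>) \<le> K * K"
      using sum_bounded_above[of UNIV "\<lambda>i. \<bar>E n $ i\<bar>" K] by (simp add: K_def)
    then show ?thesis
      using norm_le_l1_cart[of "E n"] by linarith
  qed
  then have bound: "norm (E n /\<^sub>R real n) \<le> K * K / real n" for n
    by (simp add: divide_inverse_commute mult_left_mono)
  have "(\<lambda>n. K * K / real n) \<longlonglongrightarrow> 0"
    by real_asymp
  then have "(\<lambda>n. E n /\<^sub>R real n) \<longlonglongrightarrow> 0"
    by (rule Lim_null_comparison[OF always_eventually[OF allI[OF bound]]])
  then have "(\<lambda>n. rel_freq x n - (\<Sum>m=1..n. z m) /\<^sub>R real n) \<longlonglongrightarrow> 0"
    unfolding diff using tendsto_minus by fastforce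
  then show ?thesis by blast
qed

text \<open>Cut the mean at \<open>q = n / ln n\<close>. Beyond \<open>q\<close>, the arguments
  \<open>ln (ln m)\<close> lie within o(1) of \<open>ln (ln n)\<close>, so uniform continuity makes
  the terms close to the last one. The at most \<open>q\<close> earlier terms each differ from it by
  at most \<open>2 * B\<close> and contribute at most \<open>2 * B * q / n = 2 * B / ln n\<close>,
  which vanishes.\<close>

lemma mean_asymp_loglog:
  fixes f :: "real \<Rightarrow> 'a::real_normed_vector"
  assumes unif: "uniformly_continuous_on UNIV f" and bdd: "bounded (range f)"
  shows "(\<lambda>n. (\<Sum>m=1..n. f (ln (ln (real m)))) /\<^sub>R real n - f (ln (ln (real n)))) \<longlonglongrightarrow> 0"
proof (rule LIMSEQ_I)
  fix e :: real assume "0 < e"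
  define z where "z = (\<lambda>n::nat. f (ln (ln (real n))))"
  obtain B where B: "0 < B" "\<And>t. norm (f t) \<le> B"
    using bdd by (auto simp: bounded_pos)
  obtain d where d: "0 < d" "\<And>s t. dist s t < d \<Longrightarrow> dist (f s) (f t) < e / 3"
    using unif \<open>0 < e\<close> unfolding uniformly_continuous_on_def
    by (metis UNIV_I divide_pos_pos zero_less_numeral)
  \<comment> \<open>The difference is \<open>ln (ln n / (ln n - ln (ln n)))\<close>, which tends to
    0.\<close>
  have "\<forall>\<^sub>F n::nat in sequentially. ln (ln (real n)) - ln (ln (real n / ln (real n))) < d"
    by (rule order_tendstoD[where y = 0]) (use d in \<open>real_asymp, auto\<close>)
  moreover have "\<forall>\<^sub>F n::nat in sequentially. 3 \<le> real n / ln (real n)"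
    by real_asymp
  moreover have "\<forall>\<^sub>F n::nat in sequentially. 2 * B / ln (real n) < e / 3"
    by (rule order_tendstoD[where y = 0]) (use \<open>0 < e\<close> in \<open>real_asymp, auto\<close>)
  moreover have "\<forall>\<^sub>F n::nat in sequentially. 3 \<le> n"
    by (rule eventually_ge_at_top)
  ultimately have "\<forall>\<^sub>F n::nat in sequentially. norm ((\<Sum>m=1..n. z m) /\<^sub>R real n - z n) < e"
  proof eventually_elim
    case (elim n)
    define q where "q = real n / ln (real n)"
    \<comment> \<open>Indices up to \<open>q\<close>, among them \<open>m = 1\<close> where
      \<open>ln (ln m)\<close> is a default value, are handled by the bound \<open>B\<close> alone.
      Since \<open>3 \<le> q\<close>, the iterated logarithm is monotone on the remaining
      ones.\<close>
    have close: "norm (z m - z n) \<le> e / 3 + (if real m \<le> q then 2 * B else 0)" if "m \<in> {1..n}" for m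
    proof (cases "real m \<le> q")
      case True
      have "norm (z m - z n) \<le> 2 * B"
        using norm_triangle_ineq4[of "z m" "z n"] B(2) unfolding z_def by (smt (verit))
      then show ?thesis using True \<open>0 < e\<close> by simp
    next
      case False
      have q: "3 \<le> q" using elim by (simp add: q_def)
      have lnq: "0 < ln q"
        using q by simp
      have "ln q \<le> ln (real m)"
        using False q by simp
      then have 1: "ln (ln q) \<le> ln (ln (real m))"
        using lnq by simp
      have "ln (real m) \<le> ln (real n)"
        using that False q by simp
      moreover have "0 < ln (real m)"
        using lnq \<open>ln q \<le> ln (real m)\<close> by linarith
      ultimately have "ln (ln (real m)) \<le> ln (ln (real n))"
        by simp
      with 1 elim(1) have "dist (ln (ln (real m))) (ln (ln (real n))) < d"
        by (simp add: dist_real_def q_def)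
      then show ?thesis
        using d(2) False unfolding z_def by (fastforce simp: dist_norm)
    qed
    have "(\<Sum>m=1..n. if real m \<le> q then 2 * B else 0) = (\<Sum>m \<in> {m \<in> {1..n}. real m \<le> q}. 2 * B)"
      by (subst sum.inter_filter) auto
    also have "\<dots> = real (card {m \<in> {1..n}. real m \<le> q}) * (2 * B)"
      by simp
    also have "\<dots> \<le> q * (2 * B)"
    proof -
      have "0 \<le> q" using elim by (simp add: q_def)
      have "{m \<in> {1..n}. real m \<le> q} \<subseteq> {1..nat \<lfloor>q\<rfloor>}"
        by (auto simp: le_nat_floor)
      then have "card {m \<in> {1..n}. real m \<le> q} \<le> nat \<lfloor>q\<rfloor>"
        by (metis card_atLeastAtMost card_mono diff_Suc_1 finite_atLeastAtMost)
      then have "real (card {m \<in> {1..n}. real m \<le> q}) \<le> q"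
        using \<open>0 \<le> q\<close> by linarith
      then show ?thesis
        using B(1) by (simp add: mult_right_mono)
    qed
    finally have few: "(\<Sum>m=1..n. if real m \<le> q then 2 * B else 0) \<le> q * (2 * B)" .
    have npos: "0 < real n" using elim by simp
    have "(\<Sum>m=1..n. z m) /\<^sub>R real n - z n = (\<Sum>m=1..n. z m - z n) /\<^sub>R real n"
      using npos by (simp add: sum_subtractf scaleR_diff_right sum_constant_scaleR)
    then have "norm ((\<Sum>m=1..n. z m) /\<^sub>R real n - z n) = norm (\<Sum>m=1..n. z m - z n) / real n"
      by (simp add: divide_inverse_commute)
    also have "\<dots> \<le> (\<Sum>m=1..n. e / 3 + (if real m \<le> q then 2 * B else 0)) / real n"
      using close by (intro divide_right_mono order.trans[OF norm_sum] sum_mono) auto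
    also have "\<dots> \<le> (real n * (e / 3) + q * (2 * B)) / real n"
      using few by (intro divide_right_mono) (auto simp: sum.distrib)
    also have "\<dots> = e / 3 + 2 * B / ln (real n)"
      using npos by (simp add: q_def field_simps)
    also have "\<dots> < e"
      using elim(3) \<open>0 < e\<close> by linarith
    finally show ?case .
  qed
  then show "\<exists>no. \<forall>n\<ge>no. norm ((\<Sum>m=1..n. f (ln (ln (real m)))) /\<^sub>R real n - f (ln (ln (real n))) - 0) < e"
    by (simp add: eventually_sequentially z_def)
qed

text \<open>The indices \<open>g j\<close> may repeat and need not increase; as they pass every
  bound, infinitely many distinct ones come close to \<open>p\<close>.\<close>

lemma cluster_pointsI:
  assumes "p \<in> prob_simplex" and g: "filterlim g at_top sequentially"
    and lim: "(\<lambda>j. r (g j)) \<longlonglongrightarrow> p"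
  shows "p \<in> cluster_points r"
proof -
  have "infinite {n. 1 \<le> n \<and> norm (r n - p) < e}" if "0 < e" for e
    unfolding infinite_nat_iff_unbounded
  proof
    fix N
    \<comment> \<open>\<open>Suc N\<close> yields both \<open>N < g j\<close> and the positivity
      \<open>1 \<le> g j\<close>.\<close>
    have "\<forall>\<^sub>F j in sequentially. Suc N \<le> g j"
      using g by (simp add: filterlim_at_top)
    moreover have "\<forall>\<^sub>F j in sequentially. dist (r (g j)) p < e"
      using lim that by (rule tendstoD)
    ultimately have "\<forall>\<^sub>F j in sequentially. Suc N \<le> g j \<and> dist (r (g j)) p < e"
      by eventually_elim simp
    then obtain j where "Suc N \<le> g j" "dist (r (g j)) p < e"
      by (auto simp: eventually_sequentially)
    then show "\<exists>n>N. n \<in> {n. 1 \<le> n \<and> norm (r n - p) < e}"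
      by (intro exI[of _ "g j"]) (auto simp: dist_norm)
  qed
  with assms(1) show ?thesis
    by (simp add: cluster_points_def)
qed

text \<open>Near a cluster point \<open>p\<close> there are arbitrarily late values of
  \<open>r\<close>, and late values of \<open>r\<close> are close to points of \<open>C\<close>; so
  \<open>p\<close> lies in the closure of \<open>C\<close>.\<close>

lemma cluster_points_subset_closed:
  assumes "closed C" and z: "\<And>n. z n \<in> C" and lim: "(\<lambda>n. r n - z n) \<longlonglongrightarrow> 0"
  shows "cluster_points r \<subseteq> C"
proof
  fix p assume p: "p \<in> cluster_points r"
  have "\<exists>y\<in>C. dist y p < e" if e: "0 < e" for e
  proof -
    obtain N where N: "\<And>n. N \<le> n \<Longrightarrow> norm (r n - z n) < e / 2"
      using LIMSEQ_D[OF lim half_gt_zero[OF e]] by auto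
    have "infinite {n. 1 \<le> n \<and> norm (r n - p) < e / 2}"
      using p half_gt_zero[OF e] unfolding cluster_points_def by blast
    then obtain n where "N < n" "norm (r n - p) < e / 2"
      unfolding infinite_nat_iff_unbounded by blast
    then have "dist (z n) p < e"
      using N[of n] norm_triangle_ineq4[of "r n - p" "r n - z n"] by (simp add: dist_norm)
    with z show ?thesis by blast
  qed
  then have "p \<in> closure C"
    by (simp add: closure_approachable)
  with \<open>closed C\<close> show "p \<in> C" by simp
qed

text \<open>Precompose \<open>c\<close> with \<open>(1 + sin t) / 2\<close>, which is Lipschitz, has
  period \<open>2 * pi\<close> and sweeps the unit interval up and down. On that interval
  \<open>c\<close> is uniformly continuous by compactness.\<close>

lemma path_uniformly_continuous_on_line:
  assumes "path c"
  obtains f :: "real \<Rightarrow> 'a::metric_space"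
  where "uniformly_continuous_on UNIV f" "range f = path_image c" "\<And>t. f (t + 2 * pi) = f t"
proof
  define h where "h = (\<lambda>t. (1 + sin t) / 2 :: real)"
  have h01: "h t \<in> {0..1}" for t
    using sin_le_one[of t] sin_ge_minus_one[of t] by (auto simp: h_def simp del: sin_le_one sin_ge_minus_one)
  have "uniformly_continuous_on UNIV h"
  proof (rule lipschitz_on_uniformly_continuous)
    show "1-lipschitz_on UNIV h"
    proof (rule bounded_derivative_imp_lipschitz)
      show "(h has_derivative (*) (cos t / 2)) (at t within UNIV)" for t
        unfolding h_def has_field_derivative_def[symmetric]
        by (auto intro!: derivative_eq_intros)
      show "onorm ((*) (cos t / 2)) \<le> 1" for t :: real
      proof (rule onorm_le)
        have "\<bar>cos t / 2\<bar> \<le> 1"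
          using abs_cos_le_one[of t] by linarith
        then show "norm (cos t / 2 * u) \<le> 1 * norm u" for u
          unfolding norm_mult by (intro mult_right_mono) auto
      qed
    qed auto
  qed
  moreover have "uniformly_continuous_on (range h) c"
    using assms h01 compact_uniformly_continuous[of "{0..1}" c]
    unfolding path_def uniformly_continuous_on_def by (smt (verit) compact_Icc imageE)
  ultimately show "uniformly_continuous_on UNIV (c \<circ> h)"
    by (rule uniformly_continuous_on_compose[unfolded o_def[symmetric]])
  \<comment> \<open>An explicit preimage gives surjectivity onto the unit interval.\<close>
  have "h (arcsin (2 * s - 1)) = s" if "s \<in> {0..1}" for s
    using that by (simp add: h_def)
  then have "range h = {0..1}"
    using h01 by (metis (no_types, lifting) image_subset_iff rangeI subsetI subset_antisym)
  then show "range (c \<circ> h) = path_image c"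
    by (metis image_comp path_image_def)
  show "(c \<circ> h) (t + 2 * pi) = (c \<circ> h) t" for t
    by (simp add: h_def)
qed

theorem theorem3p3:
  fixes C :: "(real ^ 'k) set"
  assumes "rectifiable_closed_curve C"
    and "C \<subseteq> prob_simplex"
  shows "\<exists>x :: nat \<Rightarrow> 'k. cluster_points (rel_freq x) = C"
proof -
  obtain c where "path c" and c: "path_image c = C"
    using assms(1) by (auto simp: rectifiable_closed_curve_def)
  then have "compact C"
    using compact_path_image by blast
  obtain f where unif: "uniformly_continuous_on UNIV f" and range: "range f = C"
    and per: "\<And>t. f (t + 2 * pi) = f t"
    using path_uniformly_continuous_on_line[OF \<open>path c\<close>] c by metis
  have per_nat: "f (t + real j * (2 * pi)) = f t" for t j
  proof (induction j)
    case (Suc j)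
    then show ?case
      using per[of "t + real j * (2 * pi)"] by (simp add: algebra_simps)
  qed simp
  define z where "z = (\<lambda>n::nat. f (ln (ln (real n))))"
  have zC: "z n \<in> C" for n
    using range by (auto simp: z_def)
  obtain x :: "nat \<Rightarrow> 'k" where "(\<lambda>n. rel_freq x n - (\<Sum>m=1..n. z m) /\<^sub>R real n) \<longlonglongrightarrow> 0"
    using exists_rel_freq_asymp_mean[of z] zC assms(2) by blast
  moreover have "(\<lambda>n. (\<Sum>m=1..n. z m) /\<^sub>R real n - z n) \<longlonglongrightarrow> 0"
    unfolding z_def
    by (rule mean_asymp_loglog[OF unif]) (simp add: range \<open>compact C\<close> compact_imp_bounded)
  ultimately have lim: "(\<lambda>n. rel_freq x n - z n) \<longlonglongrightarrow> 0"
    using tendsto_add by fastforce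
  have "C \<subseteq> cluster_points (rel_freq x)"
  proof
    fix p assume "p \<in> C"
    then obtain t where t: "p = f t"
      using range by blast
    define s where "s = (\<lambda>j. t + real j * (2 * pi))"
    \<comment> \<open>The times \<open>s j\<close> are preimages of \<open>p\<close> under
      \<open>f\<close> by periodicity, and \<open>g j\<close> is the first index at which
      \<open>ln (ln n)\<close> reaches \<open>s j\<close>. Rounding up there shifts the iterated
      logarithm by o(1) only.\<close>
    define g where "g = (\<lambda>j. nat \<lceil>exp (exp (s j))\<rceil>)"
    have s_lim: "filterlim s at_top sequentially"
      unfolding s_def by real_asymp
    have g_lim: "filterlim g at_top sequentially"
      unfolding g_def s_def by real_asymp
    have "((\<lambda>u::real. ln (ln (real (nat \<lceil>exp (exp u)\<rceil>))) - u) \<longlongrightarrow> 0) at_top"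
      by real_asymp
    then have "(\<lambda>j. ln (ln (real (g j))) - s j) \<longlonglongrightarrow> 0"
      unfolding g_def using s_lim by (rule filterlim_compose)
    then have "(\<lambda>j. dist (ln (ln (real (g j)))) (s j)) \<longlonglongrightarrow> 0"
      unfolding dist_norm by (rule tendsto_norm_zero)
    \<comment> \<open>Uniformity matters here: \<open>s j\<close> runs off to infinity, so
      continuity at a single point would not transfer the closeness of arguments to values.\<close>
    then have "(\<lambda>j. dist (z (g j)) (f (s j))) \<longlonglongrightarrow> 0"
      using unif unfolding z_def uniformly_continuous_on_sequentially by simp
    then have "(\<lambda>j. dist (z (g j)) p) \<longlonglongrightarrow> 0"
      by (simp add: s_def per_nat t)
    then have "(\<lambda>j. z (g j)) \<longlonglongrightarrow> p"
      by (rule tendsto_dist_iff[THEN iffD2])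
    moreover have "(\<lambda>j. rel_freq x (g j) - z (g j)) \<longlonglongrightarrow> 0"
      using lim g_lim by (rule filterlim_compose)
    ultimately have "(\<lambda>j. rel_freq x (g j)) \<longlonglongrightarrow> p"
      using tendsto_add by fastforce
    with \<open>p \<in> C\<close> assms(2) g_lim show "p \<in> cluster_points (rel_freq x)"
      by (intro cluster_pointsI) auto
  qed
  moreover have "cluster_points (rel_freq x) \<subseteq> C"
    using compact_imp_closed[OF \<open>compact C\<close>] zC lim by (rule cluster_points_subset_closed)
  ultimately show ?thesis by blast
qed

end
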